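(* Let $n\ge 1$ and $d\ge 1$ be integers. For every subset $Z\subset B^n$, $$\frac{(d+1)!}{2}\,\hat{\mathcal R}_d(Z)\ \le\ \mathcal{RG}_d(Z).$$
   Context: $B^n\subset\mathbb R^n$ is the closed Euclidean unit ball. For a $C^{d+1}$ function $f:B^n\to\mathbb R$ (all partial derivatives of order at most $d+1$ exist and are continuous on $B^n$) and $0\le l\le d+1$, put $M_l(f)=\max_{z\in B^n}\|f^{(l)}(z)\|$, where $\|f^{(l)}(z)\|$ is the sum of the absolute values of all partial derivatives of $f$ of order $l$ at $z$, i.e. $\|f^{(l)}(z)\|=\sum_{(i_1,\dots,i_l)\in\{1,\dots,n\}^l}\left|\frac{\partial^l f}{\partial x_{i_1}\cdots\partial x_{i_l}}(z)\right|$; in particular $M_0(f)=\max_{B^n}|f|$. Rigidity constant: for $Z\subset B^n$, $U_d(Z)$ is the set of $C^{d+1}$ functions $f$ on $B^n$ vanishing on $Z$ (and possibly elsewhere) with $M_0(f)=1$, and $\mathcal{RG}_d(Z)=\inf_{f\in U_d(Z)}M_{d+1}(f)$, with $\inf\emptyset=+\infty$. Remez constant: $\mathcal R_d(Z)\in[1,\infty]$ is the minimal $K$ such that $\sup_{B^n}|P|\le K\sup_Z|P|$ for every real polynomial $P(x_1,\dots,x_n)$ of degree at most $d$, with $\mathcal R_d(Z)=\infty$ if no finite such $K$ exists (and $\sup_\emptyset|P|=0$). The inverse Remez constant is $\hat{\mathcal R}_d(Z)=1/\mathcal R_d(Z)$, with $1/\infty=0$. *)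

theory Defs
  imports "HOL-Analysis.Analysis"
begin

text \<open>
  Functions on the closed unit ball are represented by total functions on \<open>real^'n\<close> of which
  only the values on \<open>cball 0 1\<close> matter. At a boundary point a line parallel to a coordinate axis
  may meet the ball in that point alone, so partial derivatives are taken as two-sided derivatives
  in the open ball and are extended to the sphere by continuity.
\<close>

definition partial_deriv :: "'n \<Rightarrow> (real^'n \<Rightarrow> real) \<Rightarrow> real^'n \<Rightarrow> real" where
  "partial_deriv i f z = deriv (\<lambda>t::real. f (z + t *\<^sub>R axis i 1)) 0"

definition ball_partial :: "'n \<Rightarrow> (real^'n \<Rightarrow> real) \<Rightarrow> real^'n \<Rightarrow> real" where
  "ball_partial i f z =
     (if z \<in> ball 0 1 then partial_deriv i f z
      else Lim (at z within ball 0 1) (partial_deriv i f))"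

text \<open>The list \<open>[i\<^sub>1, \<dots>, i\<^sub>l]\<close> stands for \<open>\<partial>\<^sup>l / \<partial>x\<^bsub>i\<^sub>1\<^esub> \<dots> \<partial>x\<^bsub>i\<^sub>l\<^esub>\<close>.\<close>

primrec ball_partials :: "'n list \<Rightarrow> (real^'n \<Rightarrow> real) \<Rightarrow> real^'n \<Rightarrow> real" where
  "ball_partials [] f = f"
| "ball_partials (i # is) f = ball_partial i (ball_partials is f)"

text \<open>Continuity on the closed ball also guarantees that the limits in \<open>ball_partial\<close> exist.\<close>

definition Ck_on_ball :: "nat \<Rightarrow> (real^'n \<Rightarrow> real) \<Rightarrow> bool" where
  "Ck_on_ball k f \<longleftrightarrow>
     (\<forall>is i z. length is < k \<longrightarrow> z \<in> ball 0 1 \<longrightarrow>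
        (\<lambda>t::real. ball_partials is f (z + t *\<^sub>R axis i 1)) field_differentiable (at 0)) \<and>
     (\<forall>is. length is \<le> k \<longrightarrow> continuous_on (cball 0 1) (ball_partials is f))"

definition deriv_norm :: "nat \<Rightarrow> (real^'n \<Rightarrow> real) \<Rightarrow> real^'n \<Rightarrow> real" where
  "deriv_norm l f z = (\<Sum>is | length is = l. \<bar>ball_partials is f z\<bar>)"

text \<open>For \<open>f\<close> of class \<open>C\<^sup>l\<close> the supremum is a maximum, by compactness.\<close>

definition max_deriv_norm :: "nat \<Rightarrow> (real^'n \<Rightarrow> real) \<Rightarrow> real" where
  "max_deriv_norm l f = (SUP z\<in>cball 0 1. deriv_norm l f z)"

definition normalized_vanishing :: "nat \<Rightarrow> (real^'n) set \<Rightarrow> (real^'n \<Rightarrow> real) set" where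
  "normalized_vanishing d Z = {f. Ck_on_ball (d + 1) f \<and> (\<forall>z\<in>Z. f z = 0) \<and> max_deriv_norm 0 f = 1}"

definition rigidity :: "nat \<Rightarrow> (real^'n) set \<Rightarrow> ennreal" where
  "rigidity d Z = (INF f\<in>normalized_vanishing d Z. ennreal (max_deriv_norm (d + 1) f))"

definition multi_indices :: "nat \<Rightarrow> ('n::finite \<Rightarrow> nat) set" where
  "multi_indices d = {\<alpha>. (\<Sum>i\<in>UNIV. \<alpha> i) \<le> d}"

lemma finite_multi_indices: "finite (multi_indices d :: ('n::finite \<Rightarrow> nat) set)"
proof (rule finite_subset)
  show "multi_indices d \<subseteq> (UNIV :: 'n set) \<rightarrow>\<^sub>E {..d}"
  proof
    fix \<alpha> :: "'n \<Rightarrow> nat" assume "\<alpha> \<in> multi_indices d"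
    moreover have "\<alpha> i \<le> (\<Sum>j\<in>UNIV. \<alpha> j)" for i
      by (rule member_le_sum) auto
    ultimately show "\<alpha> \<in> UNIV \<rightarrow>\<^sub>E {..d}"
      by (auto simp: multi_indices_def intro: order_trans)
  qed
  show "finite ((UNIV :: 'n set) \<rightarrow>\<^sub>E {..d})"
    by (intro finite_PiE) auto
qed

definition polynomials_upto :: "nat \<Rightarrow> (real^'n \<Rightarrow> real) set" where
  "polynomials_upto d =
     {P. \<exists>c. \<forall>x. P x = (\<Sum>\<alpha>\<in>multi_indices d. c \<alpha> * (\<Prod>i\<in>UNIV. (x $ i) ^ \<alpha> i))}"

text \<open>In \<open>ennreal\<close> the supremum over the empty set is \<open>0\<close> and the infimum is \<open>\<infinity>\<close>.\<close>

definition sup_abs :: "'a set \<Rightarrow> ('a \<Rightarrow> real) \<Rightarrow> ennreal" where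
  "sup_abs S P = (SUP x\<in>S. ennreal \<bar>P x\<bar>)"

definition remez :: "nat \<Rightarrow> (real^'n) set \<Rightarrow> ennreal" where
  "remez d Z =
     Inf {K. K < \<infinity> \<and> (\<forall>P\<in>polynomials_upto d. sup_abs (cball 0 1) P \<le> K * sup_abs Z P)}"

definition inverse_remez :: "nat \<Rightarrow> (real^'n) set \<Rightarrow> ennreal" where
  "inverse_remez d Z = 1 / remez d Z"

end

theory Submission
  imports Defs
begin

text \<open>
  Let \<open>P\<close> be the Taylor polynomial of degree \<open>d\<close> at \<open>0\<close> of a function \<open>f\<close> that vanishes on \<open>Z\<close> and
  has maximum modulus \<open>1\<close>, and let \<open>E = M\<^bsub>d+1\<^esub>(f) / (d+1)!\<close>, so that \<open>\<bar>f - P\<bar> \<le> E\<close> on the ball.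
  Then \<open>\<bar>P\<bar> \<le> E\<close> on \<open>Z\<close>, while \<open>\<bar>P\<bar> \<ge> 1 - E\<close> at a point where \<open>\<bar>f\<bar> = 1\<close>. Hence \<open>1 - E \<le> K E\<close> for every
  admissible Remez constant \<open>K\<close>, and \<open>E \<ge> 1 / (1 + K) \<ge> 1 / (2 K)\<close> because \<open>K \<ge> 1\<close>.
\<close>

section \<open>Total differentiability from continuous partial derivatives\<close>

text \<open>The increment is made one coordinate at a time, and the mean value inequality controls
  each step. The class \<open>Ck_on_ball\<close> only speaks of derivatives parallel to the axes,
  whereas the chain rule along rays through the origin calls for the total derivative.\<close>

lemma has_derivative_continuous_partials:
  fixes F :: "real^'n \<Rightarrow> real"
  assumes "open S" and "z \<in> S"
    and deriv: "\<And>i y. y \<in> S \<Longrightarrow> ((\<lambda>t. F (y + t *\<^sub>R axis i 1)) has_real_derivative D i y) (at 0)"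
    and cont: "\<And>i. isCont (D i) z"
  shows "(F has_derivative (\<lambda>h. \<Sum>i\<in>UNIV. h $ i * D i z)) (at z)"
proof -
  \<comment> \<open>\<open>part J h\<close> keeps the coordinates of \<open>h\<close> in
    \<open>J\<close> and zeroes the others; the induction adds indices to \<open>J\<close> until
    \<open>part UNIV h = h\<close>.\<close>
  define part where "part J h = (\<Sum>i\<in>J. (h $ i) *\<^sub>R axis i (1::real))" for J :: "'n set" and h :: "real^'n"
  have part_nth: "part J h $ i = (if i \<in> J then h $ i else 0)" for J h i
    by (simp add: part_def axis_def if_distrib cong: if_cong)
  have approx: "\<exists>\<delta>>0. \<forall>h. norm h < \<delta> \<longrightarrow>
      \<bar>F (z + part J h) - F z - (\<Sum>i\<in>J. h $ i * D i z)\<bar> \<le> e * norm h"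
    if "e > 0" for e J
    using finite[of J] that
  proof (induction J arbitrary: e rule: finite_induct)
    case empty
    then show ?case by (intro exI[of _ 1]) (auto simp: part_def)
  next
    case (insert j J)
    \<comment> \<open>Half of the error is left to the coordinates already moved, half to the new
      one, which is why \<open>e\<close> varies in the induction.\<close>
    from insert.IH[of "e/2"] insert.prems obtain \<delta>1 where \<delta>1: "\<delta>1 > 0"
      "\<And>h. norm h < \<delta>1 \<Longrightarrow> \<bar>F (z + part J h) - F z - (\<Sum>i\<in>J. h $ i * D i z)\<bar> \<le> e / 2 * norm h"
      by auto
    obtain \<delta>2 where \<delta>2: "\<delta>2 > 0" "ball z \<delta>2 \<subseteq> S"
      using assms(1,2) open_contains_ball by blast
    obtain \<delta>3 where \<delta>3: "\<delta>3 > 0" "\<And>y. dist y z < \<delta>3 \<Longrightarrow> dist (D j y) (D j z) < e / 2"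
      using cont[of j] insert.prems unfolding continuous_at_eps_delta
      by (meson half_gt_zero)
    show ?case
    proof (intro exI[of _ "min \<delta>1 (min \<delta>2 \<delta>3)"] conjI allI impI)
      show "min \<delta>1 (min \<delta>2 \<delta>3) > 0" using \<delta>1 \<delta>2 \<delta>3 by simp
    next
      fix h :: "real^'n" assume h: "norm h < min \<delta>1 (min \<delta>2 \<delta>3)"
      define y where "y s = z + part J h + s *\<^sub>R axis j 1" for s :: real
      \<comment> \<open>As \<open>j\<close> is not in \<open>J\<close>, every coordinate of
        \<open>y s - z\<close> is bounded in modulus by that of \<open>h\<close>, so the path stays
        as close to \<open>z\<close> as \<open>h\<close> is short.\<close>
      have dist_y: "dist (y s) z \<le> norm h" if "s \<in> closed_segment 0 (h $ j)" for s
      proof -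
        have "\<bar>s\<bar> \<le> \<bar>h $ j\<bar>"
          using that by (auto simp: closed_segment_eq_real_ivl split: if_splits)
        then have "norm (part J h + s *\<^sub>R axis j 1) \<le> norm h"
          using insert.hyps(2)
          by (intro norm_le_componentwise_cart) (auto simp: part_nth axis_def)
        then show ?thesis by (simp add: y_def dist_norm add.assoc)
      qed
      \<comment> \<open>Subtracting the linear term leaves a function whose derivative is small by
        continuity of \<open>D j\<close> at \<open>z\<close>.\<close>
      have diff: "((\<lambda>s. F (y s) - s * D j z) has_real_derivative D j (y s) - D j z)
          (at s within closed_segment 0 (h $ j))"
        if "s \<in> closed_segment 0 (h $ j)" for s
      proof -
        have "y s \<in> S" using dist_y[OF that] h \<delta>2 by (auto simp: dist_commute subset_iff)
        from deriv[OF this, of j]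
        have "((\<lambda>t. F (y (s + t))) has_real_derivative D j (y s)) (at 0)"
          by (simp add: y_def algebra_simps)
        then have "((\<lambda>s. F (y s)) has_real_derivative D j (y s)) (at s)"
          using DERIV_shift[of "\<lambda>s. F (y s)" "D j (y s)" 0 s] by (simp add: add.commute)
        from DERIV_diff[OF this DERIV_cmult_right[OF DERIV_ident, of "D j z"]]
        show ?thesis by (simp add: has_field_derivative_at_within)
      qed
      have "norm ((F (y (h $ j)) - h $ j * D j z) - (F (y 0) - 0 * D j z)) \<le> e / 2 * norm (h $ j - 0)"
      proof (rule field_differentiable_bound[OF convex_closed_segment diff])
        fix s assume "s \<in> closed_segment 0 (h $ j)"
        then show "norm (D j (y s) - D j z) \<le> e / 2"
          using dist_y[of s] \<delta>3(2)[of "y s"] h by (simp add: dist_norm)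
      qed auto
      also have "\<dots> \<le> e / 2 * norm h"
        using insert.prems component_le_norm_cart[of h j] by (intro mult_left_mono) auto
      finally have "\<bar>F (z + part (insert j J) h) - h $ j * D j z - F (z + part J h)\<bar> \<le> e / 2 * norm h"
        using insert.hyps by (simp add: y_def part_def add_ac)
      moreover have "\<bar>F (z + part J h) - F z - (\<Sum>i\<in>J. h $ i * D i z)\<bar> \<le> e / 2 * norm h"
        using \<delta>1(2) h by simp
      ultimately have "\<bar>(F (z + part (insert j J) h) - h $ j * D j z - F (z + part J h)) +
          (F (z + part J h) - F z - (\<Sum>i\<in>J. h $ i * D i z))\<bar> \<le> e / 2 * norm h + e / 2 * norm h"
        by (rule abs_triangle_ineq[THEN order_trans, OF add_mono])
      then show "\<bar>F (z + part (insert j J) h) - F z - (\<Sum>i\<in>insert j J. h $ i * D i z)\<bar> \<le> e * norm h"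
        using insert.hyps by (simp add: algebra_simps)
    qed
  qed
  have part_UNIV: "part UNIV h = h" for h
    by (simp add: vec_eq_iff part_nth)
  show ?thesis
    unfolding has_derivative_at_alt
  proof (intro conjI allI impI)
    show "bounded_linear (\<lambda>h. \<Sum>i\<in>UNIV. h $ i * D i z)"
      by (intro bounded_linear_sum bounded_linear_mult_const bounded_linear_vec_nth)
  next
    fix e :: real assume "e > 0"
    from approx[OF this, of UNIV] obtain \<delta> where \<delta>: "\<delta> > 0"
      "\<And>h. norm h < \<delta> \<Longrightarrow> \<bar>F (z + h) - F z - (\<Sum>i\<in>UNIV. h $ i * D i z)\<bar> \<le> e * norm h"
      by (auto simp: part_UNIV)
    then show "\<exists>\<delta>>0. \<forall>y. norm (y - z) < \<delta> \<longrightarrow>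
        norm (F y - F z - (\<Sum>i\<in>UNIV. (y - z) $ i * D i z)) \<le> e * norm (y - z)"
      by (intro exI[of _ \<delta>] conjI allI impI) (use \<delta>(2)[of "_ - z"] in auto)
  qed
qed

text \<open>Restricted to the open ball, because on the sphere \<open>ball_partial\<close> is a
  limit rather than a derivative.\<close>

lemma Ck_on_ball_has_derivative:
  fixes f :: "real^'n \<Rightarrow> real"
  assumes f: "Ck_on_ball k f" and len: "length is < k" and z: "z \<in> ball 0 1"
  shows "(ball_partials is f has_derivative (\<lambda>h. \<Sum>i\<in>UNIV. h $ i * ball_partials (i # is) f z)) (at z)"
proof (rule has_derivative_continuous_partials[OF open_ball z])
  fix i and y :: "real^'n" assume y: "y \<in> ball 0 1"
  with f len have "(\<lambda>t. ball_partials is f (y + t *\<^sub>R axis i 1)) field_differentiable (at 0)"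
    by (simp add: Ck_on_ball_def)
  then show "((\<lambda>t. ball_partials is f (y + t *\<^sub>R axis i 1)) has_real_derivative
      ball_partials (i # is) f y) (at 0)"
    using y by (simp add: ball_partial_def partial_deriv_def field_differentiable_derivI
        DERIV_deriv_iff_field_differentiable)
next
  fix i
  have "continuous_on (cball 0 1) (ball_partials (i # is) f)"
    using f len unfolding Ck_on_ball_def by (metis Suc_leI length_Cons)
  then have "continuous_on (ball 0 1) (ball_partials (i # is) f)"
    using ball_subset_cball continuous_on_subset by blast
  then show "isCont (ball_partials (i # is) f) z"
    using z by (metis continuous_on_eq_continuous_at open_ball)
qed

section \<open>Taylor expansion along rays\<close>

lemma sum_lists_Suc:
  fixes g :: "'n::finite list \<Rightarrow> 'a::comm_monoid_add"
  shows "(\<Sum>is | length is = Suc k. g is) = (\<Sum>is | length is = k. \<Sum>i\<in>UNIV. g (i # is))"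
proof -
  have "(\<Sum>is | length is = Suc k. g is) =
      (\<Sum>(is, i)\<in>{is. length is = k} \<times> UNIV. g (i # is))"
    by (rule sum.reindex_bij_witness[of _ "\<lambda>(is, i). i # is" "\<lambda>is. (tl is, hd is)"])
       (auto simp: length_Suc_conv)
  then show ?thesis by (simp add: sum.cartesian_product)
qed

text \<open>The \<open>k\<close>-th differential of \<open>f\<close> at \<open>z\<close> evaluated
  on \<open>(x, ..., x)\<close>. Summing over index lists makes it comparable with
  \<open>deriv_norm\<close> term by term.\<close>

definition directional_deriv :: "nat \<Rightarrow> (real^'n \<Rightarrow> real) \<Rightarrow> real^'n \<Rightarrow> real^'n \<Rightarrow> real" where
  "directional_deriv k f z x = (\<Sum>is | length is = k. ball_partials is f z * prod_list (map (($) x) is))"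

lemma DERIV_directional_deriv:
  fixes f :: "real^'n \<Rightarrow> real"
  assumes f: "Ck_on_ball m f" and "k < m" and z: "t *\<^sub>R x \<in> ball 0 1"
  shows "((\<lambda>t. directional_deriv k f (t *\<^sub>R x) x) has_real_derivative
    directional_deriv (Suc k) f (t *\<^sub>R x) x) (at t)"
proof -
  have "((\<lambda>t. ball_partials is f (t *\<^sub>R x)) has_real_derivative
      (\<Sum>i\<in>UNIV. x $ i * ball_partials (i # is) f (t *\<^sub>R x))) (at t)" if "length is = k" for "is"
  proof -
    have line: "((\<lambda>t. t *\<^sub>R x) has_derivative (\<lambda>s. s *\<^sub>R x)) (at t)"
      by (auto intro!: derivative_eq_intros)
    show ?thesis
      unfolding has_field_derivative_def
      by (rule has_derivative_eq_rhs[OF has_derivative_compose[OF line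
              Ck_on_ball_has_derivative[OF f _ z, of "is"]]])
         (use that \<open>k < m\<close> in \<open>simp_all add: fun_eq_iff sum_distrib_right sum_distrib_left mult_ac
            del: ball_partials.simps\<close>)
  qed
  then have "((\<lambda>t. directional_deriv k f (t *\<^sub>R x) x) has_real_derivative
      (\<Sum>is | length is = k. (\<Sum>i\<in>UNIV. x $ i * ball_partials (i # is) f (t *\<^sub>R x)) *
        prod_list (map (($) x) is))) (at t)"
    unfolding directional_deriv_def
    by (intro DERIV_sum DERIV_cmult_right) auto
  then show ?thesis
    \<comment> \<open>The index \<open>i\<close> produced by the chain rule becomes the head of a
      list of length \<open>Suc k\<close>, and its factor \<open>x $ i\<close> joins the
      product.\<close>
    by (simp add: directional_deriv_def sum_lists_Suc sum_distrib_right sum_distrib_left mult_ac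
        del: ball_partials.simps)
qed

lemma abs_prod_list_nth_le_1:
  fixes x :: "real^'n"
  assumes "norm x \<le> 1"
  shows "\<bar>prod_list (map (($) x) is)\<bar> \<le> 1"
proof (induction "is")
  case (Cons i "is")
  have "\<bar>x $ i\<bar> \<le> 1" using assms component_le_norm_cart[of x i] by linarith
  with Cons show ?case by (simp add: abs_mult mult_le_one)
qed simp

text \<open>On the unit ball every product of coordinates has modulus at most 1, so the absolute
  values of the partial derivatives bound the sum.\<close>

lemma abs_directional_deriv_le:
  assumes "norm x \<le> 1"
  shows "\<bar>directional_deriv k f z x\<bar> \<le> deriv_norm k f z"
  unfolding directional_deriv_def deriv_norm_def
  by (rule order_trans[OF sum_abs])
     (auto simp: abs_mult intro!: sum_mono mult_left_le abs_prod_list_nth_le_1 assms)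

lemma continuous_on_deriv_norm:
  assumes "Ck_on_ball m f" and "k \<le> m"
  shows "continuous_on (cball 0 1) (deriv_norm k f)"
  unfolding deriv_norm_def[abs_def]
  using assms by (intro continuous_on_sum continuous_on_rabs) (auto simp: Ck_on_ball_def)

lemma deriv_norm_le_max:
  assumes "Ck_on_ball m f" and "k \<le> m" and "z \<in> cball 0 1"
  shows "deriv_norm k f z \<le> max_deriv_norm k f"
proof -
  have "compact (deriv_norm k f ` cball 0 1)"
    by (intro compact_continuous_image continuous_on_deriv_norm[OF assms(1,2)] compact_cball)
  then show ?thesis
    unfolding max_deriv_norm_def
    by (intro cSUP_upper assms bounded_imp_bdd_above compact_imp_bounded)
qed

lemma deriv_norm_0: "deriv_norm 0 f z = \<bar>f z\<bar>"
  by (simp add: deriv_norm_def)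

lemma max_deriv_norm_0_attained:
  assumes "Ck_on_ball m f"
  obtains z where "z \<in> cball 0 1" "\<bar>f z\<bar> = max_deriv_norm 0 f"
proof -
  obtain z where z: "z \<in> cball 0 1" "\<And>y. y \<in> cball 0 1 \<Longrightarrow> deriv_norm 0 f y \<le> deriv_norm 0 f z"
    using continuous_attains_sup[OF compact_cball _ continuous_on_deriv_norm[OF assms le0]]
    by fastforce
  then have "deriv_norm 0 f z = max_deriv_norm 0 f"
    unfolding max_deriv_norm_def by (intro cSup_eq_maximum[symmetric]) auto
  with z that show ?thesis by (simp add: deriv_norm_0)
qed

definition taylor_polynomial :: "nat \<Rightarrow> (real^'n \<Rightarrow> real) \<Rightarrow> real^'n \<Rightarrow> real" where
  "taylor_polynomial d f x = (\<Sum>k<Suc d. directional_deriv k f 0 x / fact k)"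

text \<open>Maclaurin's formula with Lagrange remainder for
  \<open>t \<mapsto> f (t *\<^sub>R x)\<close> on [0, 1]. With \<open>x\<close> in the open ball,
  the whole segment including its end \<open>t = 1\<close> lies where the derivatives are
  two-sided.\<close>

lemma taylor_remainder_ball:
  fixes f :: "real^'n \<Rightarrow> real"
  assumes f: "Ck_on_ball (Suc d) f" and x: "x \<in> ball 0 1"
  shows "\<bar>f x - taylor_polynomial d f x\<bar> \<le> max_deriv_norm (Suc d) f / fact (Suc d)"
proof -
  have seg: "t *\<^sub>R x \<in> ball 0 1" if "0 \<le> t" "t \<le> 1" for t
    using that x mult_left_le_one_le[of "norm x" t] by (simp add: order_le_less_trans)
  have "directional_deriv 0 f y x = f y" for y
    by (simp add: directional_deriv_def)
  then obtain t where t: "0 < t" "t < 1"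
    "f x = taylor_polynomial d f x + directional_deriv (Suc d) f (t *\<^sub>R x) x / fact (Suc d)"
    using Maclaurin[of 1 "Suc d" "\<lambda>k t. directional_deriv k f (t *\<^sub>R x) x" "\<lambda>t. f (t *\<^sub>R x)"]
      DERIV_directional_deriv[OF f _ seg]
    by (auto simp: taylor_polynomial_def simp del: fact_Suc)
  have "\<bar>directional_deriv (Suc d) f (t *\<^sub>R x) x\<bar> \<le> max_deriv_norm (Suc d) f"
    using abs_directional_deriv_le[of x "Suc d" f "t *\<^sub>R x"] seg[of t] t x
      deriv_norm_le_max[OF f order_refl, of "t *\<^sub>R x"] by simp
  with t(3) show ?thesis
    by (simp add: divide_right_mono del: fact_Suc)
qed

section \<open>The Taylor polynomial as a polynomial of degree at most \<open>d\<close>\<close>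

lemma polynomials_upto_sum:
  assumes "\<And>a. a \<in> A \<Longrightarrow> P a \<in> polynomials_upto d"
  shows "(\<lambda>x. \<Sum>a\<in>A. P a x) \<in> polynomials_upto d"
proof -
  from assms obtain c where c: "\<And>a x. a \<in> A \<Longrightarrow>
      P a x = (\<Sum>\<alpha>\<in>multi_indices d. c a \<alpha> * (\<Prod>i\<in>UNIV. (x $ i) ^ \<alpha> i))"
    unfolding polynomials_upto_def by simp metis
  have "(\<Sum>a\<in>A. P a x) = (\<Sum>\<alpha>\<in>multi_indices d. (\<Sum>a\<in>A. c a \<alpha>) * (\<Prod>i\<in>UNIV. (x $ i) ^ \<alpha> i))" for x
    by (simp add: c sum_distrib_right sum.swap[of _ A])
  then show ?thesis unfolding polynomials_upto_def
    by (intro CollectI exI[of _ "\<lambda>\<alpha>. \<Sum>a\<in>A. c a \<alpha>"]) simp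
qed

lemma polynomials_upto_monomial:
  fixes \<alpha> :: "'n::finite \<Rightarrow> nat"
  assumes "\<alpha> \<in> multi_indices d"
  shows "(\<lambda>x. a * (\<Prod>i\<in>UNIV. (x $ i) ^ \<alpha> i)) \<in> polynomials_upto d"
  unfolding polynomials_upto_def
  using assms
  by (auto intro!: exI[of _ "\<lambda>\<beta>. if \<beta> = \<alpha> then a else 0"]
      simp: if_distrib[of "\<lambda>u. u * _"] finite_multi_indices cong: if_cong)

text \<open>Passes from the ordered index lists of the derivatives to the exponents used in
  \<open>polynomials_upto\<close>.\<close>

lemma prod_list_eq_prod_count:
  fixes x :: "real^'n"
  shows "prod_list (map (($) x) is) = (\<Prod>i\<in>UNIV. (x $ i) ^ count_list is i)"
proof (induction "is")
  case (Cons j "is")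
  have "(\<Prod>i\<in>UNIV. (x $ i) ^ count_list (j # is) i) =
      (\<Prod>i\<in>UNIV. (if i = j then x $ i else 1) * (x $ i) ^ count_list is i)"
    by (intro prod.cong) auto
  with Cons show ?case by (simp add: prod.distrib)
qed simp

lemma count_list_multi_index:
  fixes "is" :: "'n::finite list"
  assumes "length is \<le> d"
  shows "count_list is \<in> multi_indices d"
proof -
  have "(\<Sum>i\<in>UNIV. count_list is i) = length is"
    using sum_count_set[of "is" UNIV] by simp
  with assms show ?thesis by (simp add: multi_indices_def)
qed

lemma taylor_polynomial_in_polynomials_upto:
  "taylor_polynomial d f \<in> polynomials_upto d"
proof -
  have "(\<lambda>x. \<Sum>k<Suc d. \<Sum>is | length is = k.
      ball_partials is f 0 / fact k * (\<Prod>i\<in>UNIV. (x $ i) ^ count_list is i)) \<in> polynomials_upto d"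
    by (intro polynomials_upto_sum polynomials_upto_monomial count_list_multi_index) auto
  then show ?thesis
    by (simp add: taylor_polynomial_def[abs_def] directional_deriv_def prod_list_eq_prod_count
        sum_divide_distrib del: sum.lessThan_Suc)
qed

lemma continuous_on_polynomials_upto:
  assumes "P \<in> polynomials_upto d"
  shows "continuous_on S P"
proof -
  from assms obtain c where "P = (\<lambda>x. \<Sum>\<alpha>\<in>multi_indices d. c \<alpha> * (\<Prod>i\<in>UNIV. (x $ i) ^ \<alpha> i))"
    by (auto simp: polynomials_upto_def)
  then show ?thesis by (auto intro!: continuous_intros)
qed

text \<open>Both sides of the estimate on the open ball are continuous, so it extends to the
  closure.\<close>

lemma taylor_remainder:
  fixes f :: "real^'n \<Rightarrow> real"
  assumes f: "Ck_on_ball (Suc d) f" and x: "x \<in> cball 0 1"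
  shows "\<bar>f x - taylor_polynomial d f x\<bar> \<le> max_deriv_norm (Suc d) f / fact (Suc d)"
proof -
  have "continuous_on (cball 0 1) (ball_partials [] f)"
    using f unfolding Ck_on_ball_def by (metis le0 list.size(3))
  then have "continuous_on (closure (ball 0 1)) (\<lambda>x. f x - taylor_polynomial d f x)"
    by (auto intro!: continuous_on_diff
        continuous_on_polynomials_upto[OF taylor_polynomial_in_polynomials_upto])
  from continuous_on_closure_norm_le[OF this, of "max_deriv_norm (Suc d) f / fact (Suc d)" x]
  show ?thesis using taylor_remainder_ball[OF f] x by simp
qed

section \<open>Remez constants and the rigidity bound\<close>

text \<open>Test with the constant polynomial 1.\<close>

lemma remez_constant_ge_1:
  assumes K: "\<forall>P\<in>polynomials_upto d. sup_abs (cball 0 1) P \<le> K * sup_abs (Z :: (real^'n) set) P"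
  shows "K \<ge> 1"
proof -
  have "(\<lambda>x::real^'n. 1) \<in> polynomials_upto d"
    using polynomials_upto_monomial[of "\<lambda>_::'n. 0" d 1] by (simp add: multi_indices_def)
  with K have "sup_abs (cball (0::real^'n) 1) (\<lambda>x. 1) \<le> K * sup_abs Z (\<lambda>x. 1)" by blast
  \<comment> \<open>An inequality only, since the supremum over an empty \<open>Z\<close> is
    0.\<close>
  also have "\<dots> \<le> K * 1" by (intro mult_left_mono) (auto simp: sup_abs_def SUP_le_iff)
  finally show ?thesis by (simp add: sup_abs_def)
qed

text \<open>The product form avoids division in \<open>ennreal\<close> and shows at once that a
  finite admissible \<open>K\<close> excludes \<open>max_deriv_norm (Suc d) f = 0\<close>.\<close>

lemma remez_constant_deriv_bound:
  fixes Z :: "(real^'n) set"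
  assumes f: "f \<in> normalized_vanishing d Z" and Z: "Z \<subseteq> cball 0 1" and fin: "K < \<infinity>"
    and K: "\<forall>P\<in>polynomials_upto d. sup_abs (cball 0 1) P \<le> K * sup_abs Z P"
  shows "ennreal (fact (Suc d) / 2) \<le> K * ennreal (max_deriv_norm (Suc d) f)"
proof -
  define E where "E = max_deriv_norm (Suc d) f / fact (Suc d)"
  let ?P = "taylor_polynomial d f"
  have f_Ck: "Ck_on_ball (Suc d) f" and f_Z: "\<And>z. z \<in> Z \<Longrightarrow> f z = 0"
    and f_max: "max_deriv_norm 0 f = 1"
    using f by (auto simp: normalized_vanishing_def)
  note rem = taylor_remainder[OF f_Ck, folded E_def]
  obtain k where k: "K = ennreal k" "0 \<le> k"
    using fin by (cases K) auto
  have "k \<ge> 1" using remez_constant_ge_1[OF K] k by (simp add: ennreal_ge_1)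
  \<comment> \<open>The remainder bound at the origin puts an absolute value below
    \<open>E\<close>.\<close>
  have "0 \<le> E" using rem[of 0] by (simp add: order_trans[OF abs_ge_zero])
  obtain z where z: "z \<in> cball 0 1" "\<bar>f z\<bar> = 1"
    using max_deriv_norm_0_attained[OF f_Ck] f_max by metis
  have "ennreal \<bar>?P z\<bar> \<le> sup_abs (cball 0 1) ?P"
    unfolding sup_abs_def using z by (intro SUP_upper)
  also have "\<dots> \<le> K * sup_abs Z ?P"
    using K taylor_polynomial_in_polynomials_upto by blast
  also have "sup_abs Z ?P \<le> ennreal E"
    unfolding sup_abs_def using rem f_Z Z by (intro SUP_least ennreal_leI) fastforce
  finally have "ennreal \<bar>?P z\<bar> \<le> ennreal (k * E)"
    using k \<open>0 \<le> E\<close> by (simp add: mult_left_mono ennreal_mult)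
  then have "\<bar>?P z\<bar> \<le> k * E" using k \<open>0 \<le> E\<close> by simp
  moreover have "1 - E \<le> \<bar>?P z\<bar>" using rem[OF z(1)] z(2) by linarith
  moreover have "E \<le> k * E" using \<open>k \<ge> 1\<close> \<open>0 \<le> E\<close> by (simp add: mult_le_cancel_right1)
  \<comment> \<open>From \<open>1 \<le> k * E + E \<le> 2 * (k * E)\<close>; this is the source of
    the factor 1/2 in the theorem.\<close>
  ultimately have "1 / 2 \<le> k * E" by linarith
  then have "fact (Suc d) / 2 \<le> k * max_deriv_norm (Suc d) f"
    by (simp add: E_def field_simps del: fact_Suc)
  moreover have "0 \<le> max_deriv_norm (Suc d) f"
    using \<open>0 \<le> E\<close> fact_gt_zero[of "Suc d", where ?'a = real]
    by (simp add: E_def zero_le_divide_iff not_le[symmetric] del: fact_Suc fact_gt_zero)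
  ultimately show ?thesis
    using k by (simp add: ennreal_leI flip: ennreal_mult del: fact_Suc)
qed

theorem theorem4p1:
  fixes Z :: "(real^'n) set" and d :: nat
  assumes "d \<ge> 1" and "Z \<subseteq> cball 0 1"
  shows "ennreal (fact (d + 1) / 2) * inverse_remez d Z \<le> rigidity d Z"
  unfolding rigidity_def
proof (rule INF_greatest)
  fix f assume f: "f \<in> normalized_vanishing d Z"
  let ?a = "ennreal (fact (Suc d) / 2)" and ?M = "ennreal (max_deriv_norm (Suc d) f)"
  have bound: "?a \<le> K * ?M"
    if "K < \<infinity>" "\<forall>P\<in>polynomials_upto d. sup_abs (cball 0 1) P \<le> K * sup_abs Z P" for K
    using remez_constant_deriv_bound[OF f assms(2) that] .
  have a_pos: "0 < ?a" by (simp del: fact_Suc)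
  have "?a / remez d Z \<le> ?M"
  proof (cases "remez d Z = \<infinity>")
    case False
    \<comment> \<open>The infimum of the empty set is \<infinity>, so a finite Remez constant yields
      an admissible \<open>K\<close>, which forces \<open>?M\<close> to be nonzero.\<close>
    then have "\<exists>K. K < \<infinity> \<and> (\<forall>P\<in>polynomials_upto d. sup_abs (cball 0 1) P \<le> K * sup_abs Z P)"
      by (rule contrapos_np) (auto simp: remez_def)
    then have M: "?M \<noteq> 0" using bound a_pos by fastforce
    \<comment> \<open>Dividing by \<open>?M\<close> isolates \<open>K\<close>, so that the bound for
      all admissible \<open>K\<close> passes to their infimum.\<close>
    have "?a / ?M \<le> remez d Z"
      unfolding remez_def
    proof (rule Inf_greatest, clarify)
      fix K assume "K < \<infinity>" "\<forall>P\<in>polynomials_upto d. sup_abs (cball 0 1) P \<le> K * sup_abs Z P"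
      from bound[OF this] show "?a / ?M \<le> K"
        using M by (intro divide_le_posI_ennreal) (simp_all add: mult.commute zero_less_iff_neq_zero)
    qed
    then have "?a / ?M * ?M \<le> remez d Z * ?M" by (intro mult_right_mono) auto
    then have "?a \<le> remez d Z * ?M"
      using M by (simp add: ennreal_divide_times ennreal_divide_self del: fact_Suc)
    \<comment> \<open>Makes the divisor in the goal positive.\<close>
    moreover have "1 \<le> remez d Z"
      unfolding remez_def by (rule Inf_greatest) (use remez_constant_ge_1 in blast)
    ultimately show ?thesis
      by (intro divide_le_posI_ennreal) (auto intro: order_less_le_trans[OF zero_less_one])
  \<comment> \<open>If the Remez constant is \<infinity>, the quotient is 0.\<close>
  qed simp
  then show "ennreal (fact (d + 1) / 2) * inverse_remez d Z \<le> ennreal (max_deriv_norm (d + 1) f)"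
    by (simp add: inverse_remez_def ennreal_times_divide del: fact_Suc)
qed

end
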